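(* Let $a$ and $k$ be positive integers. Then: (1) If $s$ is a positive integer with $s > k(\sqrt{a} + \sqrt{a+1})$, then $\tau_s(a) \geq k$; consequently $\tau_s(a) \to \infty$ as $s \to \infty$. (2) For every positive integer $s$, $\tau_{s+1}(a) - \tau_s(a) \in \{-1, 0, 1\}$. (3) The first nonzero term of the sequence $(\tau_s(a))_{s \in \mathbb{Z}^+}$ equals $1$; that is, if $s$ is the least positive integer such that the open interval $(s^2 a, s^2(a+1))$ contains the square of an integer, then it contains exactly one such square of a positive integer.
   Context: For a positive integer $a$ and a positive integer $s$, let $T_s(a)$ be the set of all positive integers $t$ with $s^2 a < t^2 < s^2(a+1)$, and let $\tau_s(a) = |T_s(a)|$. *)

theory Defs
  imports Complex_Main
begin

definition T :: "nat \<Rightarrow> nat \<Rightarrow> nat set" where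
  "T s a = {t. 0 < t \<and> s\<^sup>2 * a < t\<^sup>2 \<and> t\<^sup>2 < s\<^sup>2 * (a + 1)}"

definition \<tau> :: "nat \<Rightarrow> nat \<Rightarrow> nat" where
  "\<tau> s a = card (T s a)"

(* Needed for card to be the genuine number of elements. *)
lemma finite_T: "finite (T s a)"
proof (rule finite_subset)
  show "T s a \<subseteq> {..s\<^sup>2 * (a + 1)}"
  proof
    fix t assume "t \<in> T s a"
    then have "t\<^sup>2 < s\<^sup>2 * (a + 1)" by (simp add: T_def)
    moreover have "t \<le> t\<^sup>2" by (simp add: power2_nat_le_imp_le)
    ultimately show "t \<in> {..s\<^sup>2 * (a + 1)}" by simp
  qed
qed simp

end

theory Submission
  imports Defs
begin

text \<open>
  For \<open>s > 0\<close> the count is \<open>\<lceil>s \<beta>\<rceil> - \<lfloor>s \<alpha>\<rfloor> - 1\<close> with \<open>\<alpha> = sqrt a\<close> and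
  \<open>\<beta> = sqrt (a + 1)\<close>.  Part (1) follows from \<open>\<beta> - \<alpha> = 1 / (\<alpha> + \<beta>)\<close>.  No square lies strictly
  between \<open>a\<close> and \<open>a + 1\<close>, so \<open>A \<le> \<alpha> < \<beta> \<le> A + 1\<close> for \<open>A = \<lfloor>\<alpha>\<rfloor>\<close>; hence the ceiling
  and the floor each grow by \<open>A\<close> or \<open>A + 1\<close> when \<open>s\<close> increases by one, which gives part (2).
  As \<open>\<tau> 1 a = 0\<close> and steps are at most one, the first nonzero value is one.
\<close>

text \<open>Square roots are strictly monotone, so both quadratic bounds become linear in
  \<open>t\<close>; positivity of \<open>t\<close> comes from \<open>t\<^sup>2\<close> exceeding a
  natural number.\<close>

lemma mem_T_iff_sqrt:
  "t \<in> T s a \<longleftrightarrow> real s * sqrt (real a) < real t \<and> real t < real s * sqrt (real (a + 1))"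
proof -
  have root: "real s * sqrt (real b) = sqrt (real (s\<^sup>2 * b))" for b
    by (simp add: real_sqrt_mult)
  have t: "real t = sqrt (real (t\<^sup>2))" by simp
  have pos: "0 < t" if "s\<^sup>2 * a < t\<^sup>2" using that by (cases t) auto
  show ?thesis
    unfolding T_def root t real_sqrt_less_iff of_nat_less_iff using pos by auto
qed

text \<open>An integer exceeds a real iff it exceeds its floor, and lies below a real iff it lies
  below its ceiling, so \<open>T s a\<close> is an open interval of integers. At
  \<open>s = 0\<close> the formula would give -1.\<close>

lemma tau_eq_ceiling_floor:
  assumes "0 < s"
  shows "int (\<tau> s a) = \<lceil>real s * sqrt (real (a + 1))\<rceil> - \<lfloor>real s * sqrt (real a)\<rfloor> - 1"
proof -
  let ?l = "\<lfloor>real s * sqrt (real a)\<rfloor>" and ?u = "\<lceil>real s * sqrt (real (a + 1))\<rceil>"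
  have l0: "0 \<le> ?l" by simp
  have "real s * sqrt (real a) < real s * sqrt (real (a + 1))" using assms by simp
  \<comment> \<open>Guarantees that \<open>?u - ?l - 1\<close> is nonnegative, so the cardinality of
    the interval is not truncated to 0.\<close>
  then have lu: "?l < ?u" by linarith
  have mem: "t \<in> T s a \<longleftrightarrow> ?l < int t \<and> int t < ?u" for t
    unfolding mem_T_iff_sqrt less_ceiling_iff floor_less_iff by simp
  have "int ` T s a = {?l <..< ?u}"
  proof
    show "int ` T s a \<subseteq> {?l <..< ?u}" by (auto simp: mem simp del: of_nat_add)
    show "{?l <..< ?u} \<subseteq> int ` T s a"
    proof
      fix z assume z: "z \<in> {?l <..< ?u}"
      then have "?l < z" by (simp only: greaterThanLessThan_iff)
      then have "int (nat z) = z" using l0 by linarith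
      then have "nat z \<in> T s a" using z by (simp only: mem greaterThanLessThan_iff)
      then show "z \<in> int ` T s a" using \<open>int (nat z) = z\<close> by (metis imageI)
    qed
  qed
  then have "\<tau> s a = card {?l <..< ?u}"
    unfolding \<tau>_def by (metis card_image inj_on_of_nat)
  then show ?thesis using lu by simp
qed

lemma le_tau:
  assumes s: "real s > real k * (sqrt (real a) + sqrt (real (a + 1)))"
  shows "k \<le> \<tau> s a"
proof -
  let ?x = "sqrt (real a)" and ?y = "sqrt (real (a + 1))"
  have sum_pos: "0 < ?x + ?y" by (simp add: add_nonneg_pos)
  have "0 \<le> real k * (?x + ?y)" using sum_pos by simp
  with s have s0: "0 < s" by linarith
  have "(?y - ?x) * (?x + ?y) = ?y\<^sup>2 - ?x\<^sup>2"
    by (simp only: power2_eq_square algebra_simps)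
  then have "(?y - ?x) * (?x + ?y) = 1" by simp
  then have "real s = real s * (?y - ?x) * (?x + ?y)" by (simp only: mult.assoc mult_1_right)
  with s have "real k * (?x + ?y) < real s * (?y - ?x) * (?x + ?y)" by linarith
  then have "real k < real s * (?y - ?x)"
    using sum_pos mult_less_cancel_right_pos by blast
  then have "real k < real s * ?y - real s * ?x" by (simp only: right_diff_distrib)
  \<comment> \<open>Rounding outwards only widens the gap. It strictly exceeds the integer
    \<open>k\<close>, which absorbs the -1 in the counting formula.\<close>
  then have "int k < \<lceil>real s * ?y\<rceil> - \<lfloor>real s * ?x\<rfloor>" by linarith
  then show ?thesis using tau_eq_ceiling_floor[OF s0, of a] by linarith
qed

lemma tau_filterlim_at_top: "filterlim (\<lambda>s. \<tau> s a) at_top sequentially"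
  unfolding filterlim_at_top
proof
  fix k
  obtain N where N: "real k * (sqrt (real a) + sqrt (real (a + 1))) < real N"
    using reals_Archimedean2 by blast
  have "k \<le> \<tau> s a" if "N \<le> s" for s
    using N that by (intro le_tau) linarith
  then show "eventually (\<lambda>s. k \<le> \<tau> s a) sequentially"
    by (auto simp: eventually_sequentially)
qed

text \<open>Integrality: for \<open>n\<close> = \<lfloor>sqrt a\<rfloor> + 1, a <
  \<open>n\<^sup>2\<close> forces a + 1 \<le> \<open>n\<^sup>2\<close>. Equality occurs when a + 1
  is a square.\<close>

lemma sqrt_Suc_le_floor_sqrt: "sqrt (real (a + 1)) \<le> real_of_int (\<lfloor>sqrt (real a)\<rfloor> + 1)"
proof -
  obtain n where n: "\<lfloor>sqrt (real a)\<rfloor> + 1 = int n"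
    using zero_le_imp_eq_int[of "\<lfloor>sqrt (real a)\<rfloor> + 1"] by auto
  have "sqrt (real a) < real n" using n by linarith
  then have "sqrt (real a) < sqrt (real (n\<^sup>2))" by simp
  then have "a < n\<^sup>2" unfolding real_sqrt_less_iff of_nat_less_iff .
  then have "sqrt (real (a + 1)) \<le> sqrt (real (n\<^sup>2))"
    unfolding real_sqrt_le_iff of_nat_le_iff by simp
  then show ?thesis using n by simp
qed

lemma tau_step:
  assumes "0 < s"
  shows "int (\<tau> (s + 1) a) - int (\<tau> s a) \<in> {-1, 0, 1}"
proof -
  let ?x = "sqrt (real a)" and ?y = "sqrt (real (a + 1))"
  have "?x < ?y" by simp
  moreover have "real (s + 1) * ?x = real s * ?x + ?x" "real (s + 1) * ?y = real s * ?y + ?y"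
    by (simp_all add: algebra_simps)
  moreover note sqrt_Suc_le_floor_sqrt[of a]
  \<comment> \<open>Both \<open>?x\<close> and \<open>?y\<close> lie between the integers
    \<open>\<lfloor>?x\<rfloor>\<close> and \<open>\<lfloor>?x\<rfloor> + 1\<close>, and integer
    shifts pass through floor and ceiling. Two increments confined to the same two consecutive
    integers differ by at most one.\<close>
  ultimately have
    "\<lfloor>?x\<rfloor> \<le> \<lfloor>real (s + 1) * ?x\<rfloor> - \<lfloor>real s * ?x\<rfloor>"
    "\<lfloor>real (s + 1) * ?x\<rfloor> - \<lfloor>real s * ?x\<rfloor> \<le> \<lfloor>?x\<rfloor> + 1"
    "\<lfloor>?x\<rfloor> \<le> \<lceil>real (s + 1) * ?y\<rceil> - \<lceil>real s * ?y\<rceil>"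
    "\<lceil>real (s + 1) * ?y\<rceil> - \<lceil>real s * ?y\<rceil> \<le> \<lfloor>?x\<rfloor> + 1"
    by linarith+
  then show ?thesis
    using tau_eq_ceiling_floor[OF assms, of a] tau_eq_ceiling_floor[of "s + 1" a] by auto
qed

lemma tau_one: "\<tau> 1 a = 0"
proof -
  have "T 1 a = {}" by (auto simp: T_def)
  then show ?thesis by (simp add: \<tau>_def)
qed

lemma first_nonzero_tau:
  assumes "0 < s" "\<And>r. 0 < r \<Longrightarrow> r < s \<Longrightarrow> \<tau> r a = 0" "\<tau> s a \<noteq> 0"
  shows "\<tau> s a = 1"
proof -
  \<comment> \<open>Makes the predecessor of \<open>s\<close> a positive index, as
    \<open>tau_step\<close> requires.\<close>
  have "s \<noteq> 1" using assms(3) tau_one by auto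
  then obtain r where r: "s = r + 1" "0 < r"
    using assms(1) that[of "s - 1"] by simp
  then show ?thesis using tau_step[of r a] assms(2)[of r] assms(3) by auto
qed

text \<open>Links the wording of part (3), which allows squares of arbitrary integers, to the count
  of positive roots: m may be replaced by its absolute value.\<close>

lemma tau_nonzero_iff_int_square:
  "\<tau> s a \<noteq> 0 \<longleftrightarrow> (\<exists>m::int. m\<^sup>2 \<in> {int (s\<^sup>2 * a) <..< int (s\<^sup>2 * (a + 1))})"
proof -
  have "(\<exists>t. t \<in> T s a) \<longleftrightarrow> (\<exists>m::int. m\<^sup>2 \<in> {int (s\<^sup>2 * a) <..< int (s\<^sup>2 * (a + 1))})"
  proof
    assume "\<exists>t. t \<in> T s a"
    then obtain t where "s\<^sup>2 * a < t\<^sup>2" "t\<^sup>2 < s\<^sup>2 * (a + 1)" by (auto simp: T_def)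
    then have "(int t)\<^sup>2 \<in> {int (s\<^sup>2 * a) <..< int (s\<^sup>2 * (a + 1))}"
      unfolding greaterThanLessThan_iff of_nat_power[symmetric] of_nat_less_iff by simp
    then show "\<exists>m::int. m\<^sup>2 \<in> {int (s\<^sup>2 * a) <..< int (s\<^sup>2 * (a + 1))}" ..
  next
    assume "\<exists>m::int. m\<^sup>2 \<in> {int (s\<^sup>2 * a) <..< int (s\<^sup>2 * (a + 1))}"
    then obtain m :: int where m: "m\<^sup>2 \<in> {int (s\<^sup>2 * a) <..< int (s\<^sup>2 * (a + 1))}" ..
    have "m\<^sup>2 = int ((nat \<bar>m\<bar>)\<^sup>2)" by simp
    then have "s\<^sup>2 * a < (nat \<bar>m\<bar>)\<^sup>2" "(nat \<bar>m\<bar>)\<^sup>2 < s\<^sup>2 * (a + 1)"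
      using m by (simp_all only: greaterThanLessThan_iff of_nat_less_iff)
    moreover from this have "0 < nat \<bar>m\<bar>" by (cases "nat \<bar>m\<bar>") auto
    ultimately show "\<exists>t. t \<in> T s a" unfolding T_def by blast
  qed
  then show ?thesis using finite_T[of s a] by (auto simp: \<tau>_def)
qed

theorem theorem1:
  fixes a k :: nat
  assumes "0 < a" and "0 < k"
  shows
    "((\<forall>s::nat. 0 < s \<and> real s > real k * (sqrt (real a) + sqrt (real (a + 1))) \<longrightarrow> \<tau> s a \<ge> k)
        \<and> filterlim (\<lambda>s. \<tau> s a) at_top sequentially)
     \<and> (\<forall>s::nat. 0 < s \<longrightarrow> int (\<tau> (s + 1) a) - int (\<tau> s a) \<in> {-1, 0, 1})
     \<and> ((\<exists>s::nat. 0 < s \<and> (\<forall>r. 0 < r \<and> r < s \<longrightarrow> \<tau> r a = 0) \<and> \<tau> s a = 1)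
        \<and> (\<forall>s::nat. 0 < s \<and> (\<exists>m::int. m\<^sup>2 \<in> {int (s\<^sup>2 * a) <..< int (s\<^sup>2 * (a + 1))})
              \<and> (\<forall>r. 0 < r \<and> r < s \<longrightarrow>
                    \<not> (\<exists>m::int. m\<^sup>2 \<in> {int (r\<^sup>2 * a) <..< int (r\<^sup>2 * (a + 1))}))
            \<longrightarrow> (\<exists>!q::nat. (\<exists>t. 0 < t \<and> q = t\<^sup>2) \<and> q \<in> {s\<^sup>2 * a <..< s\<^sup>2 * (a + 1)})))"
proof -
  have ex: "\<exists>s. 0 < s \<and> (\<forall>r. 0 < r \<and> r < s \<longrightarrow> \<tau> r a = 0) \<and> \<tau> s a = 1"
  proof -
    \<comment> \<open>The bound of part (1) with k = 1 supplies a nonzero term, so a least such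
      index exists.\<close>
    obtain N where "real 1 * (sqrt (real a) + sqrt (real (a + 1))) < real N"
      using reals_Archimedean2 by blast
    then have "\<tau> N a \<noteq> 0" using le_tau[of 1 a N] by simp
    moreover have "\<tau> 0 a = 0" by (simp add: \<tau>_def T_def)
    ultimately have N: "0 < N \<and> \<tau> N a \<noteq> 0" by (cases N) auto
    define s where "s = (LEAST s. 0 < s \<and> \<tau> s a \<noteq> 0)"
    have s: "0 < s" "\<tau> s a \<noteq> 0" using LeastI[where P = "\<lambda>s. 0 < s \<and> \<tau> s a \<noteq> 0", OF N]
      by (auto simp: s_def)
    have min: "\<tau> r a = 0" if "0 < r" "r < s" for r
      using not_less_Least[of r "\<lambda>s. 0 < s \<and> \<tau> s a \<noteq> 0"] that by (auto simp: s_def)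
    show ?thesis using s min first_nonzero_tau[OF s(1) min s(2)] by blast
  qed
  have unique: "\<exists>!q. (\<exists>t. 0 < t \<and> q = t\<^sup>2) \<and> q \<in> {s\<^sup>2 * a <..< s\<^sup>2 * (a + 1)}"
    if "\<tau> s a = 1" for s
  proof -
    from that obtain t where t: "T s a = {t}" unfolding \<tau>_def by (rule card_1_singletonE)
    \<comment> \<open>Uniqueness of the positive root \<open>t\<close> carries over to its
      square.\<close>
    have mem: "u = t \<longleftrightarrow> 0 < u \<and> u\<^sup>2 \<in> {s\<^sup>2 * a <..< s\<^sup>2 * (a + 1)}" for u
      using t unfolding T_def set_eq_iff by auto
    show ?thesis
    proof (rule ex1I[of _ "t\<^sup>2"])
      show "(\<exists>u. 0 < u \<and> t\<^sup>2 = u\<^sup>2) \<and> t\<^sup>2 \<in> {s\<^sup>2 * a <..< s\<^sup>2 * (a + 1)}"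
        using mem[of t] by blast
    next
      fix q assume "(\<exists>u. 0 < u \<and> q = u\<^sup>2) \<and> q \<in> {s\<^sup>2 * a <..< s\<^sup>2 * (a + 1)}"
      then obtain u where "0 < u" "q = u\<^sup>2" "u\<^sup>2 \<in> {s\<^sup>2 * a <..< s\<^sup>2 * (a + 1)}" by blast
      then show "q = t\<^sup>2" using mem[of u] by simp
    qed
  qed
  show ?thesis
    unfolding tau_nonzero_iff_int_square[symmetric]
  proof (intro conjI allI impI)
    fix s assume "0 < s \<and> \<tau> s a \<noteq> 0 \<and> (\<forall>r. 0 < r \<and> r < s \<longrightarrow> \<not> \<tau> r a \<noteq> 0)"
    then have "\<tau> s a = 1" by (intro first_nonzero_tau) auto
    then show "\<exists>!q. (\<exists>t. 0 < t \<and> q = t\<^sup>2) \<and> q \<in> {s\<^sup>2 * a <..< s\<^sup>2 * (a + 1)}"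
      by (rule unique)
  qed (use ex in \<open>simp_all only: le_tau tau_filterlim_at_top tau_step\<close>)
qed

end
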